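(* Let $n\ge 1$, let $M>0$, and let $K\subset\mathbb{C}^n$ be a (nonempty compact) Bernstein set of parameter $M$, i.e. for every $m\in\{1,\dots,n\}$, every $d\in\mathbb{N}$ and every polynomial $P\in\mathcal{P}_d(\mathbb{C}^n)$, $$\max_{z\in K}\left|\frac{\partial P}{\partial z_m}(z)\right|\le M\,d\,\max_{z\in K}|P(z)|.$$ Then the transfinite diameter $\delta(K)$ of $K$ satisfies $$\delta(K)\ge\frac{1}{nM}.$$
   Context: $\mathbb{N}=\{0,1,2,\dots\}$. $\mathcal{P}_d(\mathbb{C}^n)$ is the space of holomorphic polynomials in $n$ complex variables with complex coefficients of total degree at most $d$; its dimension is $h_d=\binom{n+d}{n}$. For $\beta\in\mathbb{N}^n$, $|\beta|=\beta_1+\dots+\beta_n$. The graded lexicographical order on $\mathbb{N}^n$: $\beta\prec\gamma$ iff $|\beta|<|\gamma|$, or $|\beta|=|\gamma|$ and the leftmost nonzero entry of $\gamma-\beta$ is positive. Let $\alpha:\mathbb{N}\to\mathbb{N}^n$, $j\mapsto\alpha(j)=(\alpha_1(j),\dots,\alpha_n(j))$, be the increasing enumeration of $\mathbb{N}^n$ for this order (so $\alpha(0)=(0,\dots,0)$), and let $e_j(z)=z^{\alpha(j)}=z_1^{\alpha_1(j)}\cdots z_n^{\alpha_n(j)}$ for $j\in\mathbb{N}$. For points $\xi_0,\dots,\xi_{k-1}\in\mathbb{C}^n$ let $\mathrm{VDM}(\xi_0,\dots,\xi_{k-1})=\det[e_i(\xi_j)]_{i,j=0,\dots,k-1}$.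 For a compact set $K\subset\mathbb{C}^n$ let $V_k=\max_{\xi_0,\dots,\xi_{k-1}\in K}|\mathrm{VDM}(\xi_0,\dots,\xi_{k-1})|$, and let $l_d=\sum_{i=1}^d i(h_i-h_{i-1})=n\binom{n+d}{n+1}$. The transfinite diameter of $K$ is $$\delta(K)=\limsup_{d\to+\infty}V_{h_d}^{1/l_d}.$$ *)

theory Defs
  imports "HOL-Analysis.Analysis" "Jordan_Normal_Form.Determinant"
begin

no_notation Matrix.vec_index (infixl \<open>$\<close> 100)

text \<open>
  \<open>\<complex>\<^sup>n\<close> is \<open>complex ^ 'n\<close> and \<open>\<nat>\<^sup>n\<close> is \<open>nat ^ 'n\<close> with \<open>n = CARD('n)\<close>. The linear order on the index
  type \<open>'n\<close> is the left-to-right order of the coordinates.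
\<close>

definition mdeg :: "nat ^ 'n::finite \<Rightarrow> nat" where
  "mdeg \<beta> = (\<Sum>i\<in>UNIV. \<beta> $ i)"

definition zmonom :: "nat ^ 'n::finite \<Rightarrow> complex ^ 'n \<Rightarrow> complex" where
  "zmonom \<beta> z = (\<Prod>i\<in>UNIV. (z $ i) ^ (\<beta> $ i))"

definition poly_space :: "nat \<Rightarrow> (complex ^ 'n::finite \<Rightarrow> complex) set" where
  "poly_space d = {P. \<exists>c. P = (\<lambda>z. \<Sum>\<beta> | mdeg \<beta> \<le> d. c \<beta> * zmonom \<beta> z)}"

definition partial_deriv :: "'n::finite \<Rightarrow> (complex ^ 'n \<Rightarrow> complex) \<Rightarrow> complex ^ 'n \<Rightarrow> complex" where
  "partial_deriv m P z = deriv (\<lambda>w. P (\<chi> i. if i = m then w else z $ i)) (z $ m)"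

text \<open>The maxima over \<open>K\<close> are written as suprema in \<open>real\<close>; this is meant for nonempty compact \<open>K\<close>,
  where they are attained.\<close>

definition sup_norm_on :: "(complex ^ 'n::finite) set \<Rightarrow> (complex ^ 'n \<Rightarrow> complex) \<Rightarrow> real" where
  "sup_norm_on K f = (SUP z\<in>K. cmod (f z))"

definition bernstein_set :: "real \<Rightarrow> (complex ^ 'n::finite) set \<Rightarrow> bool" where
  "bernstein_set M K \<longleftrightarrow>
     (\<forall>m. \<forall>d. \<forall>P \<in> poly_space d.
        sup_norm_on K (partial_deriv m P) \<le> M * real d * sup_norm_on K P)"

definition grlex_less :: "nat ^ 'n::{finite,linorder} \<Rightarrow> nat ^ 'n::{finite,linorder} \<Rightarrow> bool" (infix \<open>\<prec>\<^sub>g\<close> 50) where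
  "\<beta> \<prec>\<^sub>g \<gamma> \<longleftrightarrow>
     mdeg \<beta> < mdeg \<gamma> \<or>
     mdeg \<beta> = mdeg \<gamma> \<and> (\<exists>i. \<beta> $ i < \<gamma> $ i \<and> (\<forall>j<i. \<beta> $ j = \<gamma> $ j))"

definition grlex_enum :: "nat \<Rightarrow> nat ^ 'n::{finite,linorder}" where
  "grlex_enum = (THE f. bij f \<and> (\<forall>i j. i < j \<longrightarrow> f i \<prec>\<^sub>g f j))"

lemma finite_mdeg_le: "finite {\<beta> :: nat ^ 'n::finite. mdeg \<beta> \<le> d}"
proof -
  have "{\<beta> :: nat ^ 'n. mdeg \<beta> \<le> d} \<subseteq> vec_lambda ` (UNIV \<rightarrow>\<^sub>E {..d})"
  proof
    fix \<beta> :: "nat ^ 'n" assume "\<beta> \<in> {\<beta>. mdeg \<beta> \<le> d}"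
    then have "\<beta> $ i \<le> d" for i
      using member_le_sum[of i UNIV "($) \<beta>"] by (auto simp: mdeg_def)
    then have "($) \<beta> \<in> UNIV \<rightarrow>\<^sub>E {..d}" by auto
    then show "\<beta> \<in> vec_lambda ` (UNIV \<rightarrow>\<^sub>E {..d})"
      by (metis image_eqI vec_nth_inverse)
  qed
  then show ?thesis by (rule finite_subset) (simp add: finite_PiE)
qed

lemma grlex_irrefl: "\<not> \<beta> \<prec>\<^sub>g \<beta>"
  by (auto simp: grlex_less_def)

lemma grlex_trans: "\<beta> \<prec>\<^sub>g \<gamma> \<Longrightarrow> \<gamma> \<prec>\<^sub>g \<delta> \<Longrightarrow> \<beta> \<prec>\<^sub>g \<delta>"
proof -
  assume a: "\<beta> \<prec>\<^sub>g \<gamma>" and b: "\<gamma> \<prec>\<^sub>g \<delta>"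
  show "\<beta> \<prec>\<^sub>g \<delta>"
  proof (cases "mdeg \<beta> < mdeg \<gamma> \<or> mdeg \<gamma> < mdeg \<delta>")
    case True
    then show ?thesis using a b by (auto simp: grlex_less_def)
  next
    case False
    then obtain i k where i: "\<beta> $ i < \<gamma> $ i" "\<forall>j<i. \<beta> $ j = \<gamma> $ j"
      and k: "\<gamma> $ k < \<delta> $ k" "\<forall>j<k. \<gamma> $ j = \<delta> $ j"
      and d: "mdeg \<beta> = mdeg \<delta>"
      using a b by (auto simp: grlex_less_def)
    have "\<beta> $ min i k < \<delta> $ min i k \<and> (\<forall>j<min i k. \<beta> $ j = \<delta> $ j)"
      using i k by (cases i k rule: linorder_cases) (auto simp: min_def)
    then show ?thesis using d by (auto simp: grlex_less_def)
  qed
qed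

lemma grlex_total:
  assumes "\<beta> \<noteq> \<gamma>" shows "\<beta> \<prec>\<^sub>g \<gamma> \<or> \<gamma> \<prec>\<^sub>g \<beta>"
proof (cases "mdeg \<beta> = mdeg \<gamma>")
  case True
  let ?D = "{i. \<beta> $ i \<noteq> \<gamma> $ i}"
  have ne: "?D \<noteq> {}" using assms by (auto simp: Finite_Cartesian_Product.vec_eq_iff)
  then have "Min ?D \<in> ?D" by (intro Min_in) auto
  moreover have "\<forall>j<Min ?D. \<beta> $ j = \<gamma> $ j"
  proof (intro allI impI)
    fix j assume j: "j < Min ?D"
    show "\<beta> $ j = \<gamma> $ j"
    proof (rule ccontr)
      assume "\<beta> $ j \<noteq> \<gamma> $ j"
      then have "Min ?D \<le> j" by (intro Min_le) simp_all
      then show False using j by simp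
    qed
  qed
  ultimately obtain i where i: "\<beta> $ i \<noteq> \<gamma> $ i" "\<forall>j<i. \<beta> $ j = \<gamma> $ j" by blast
  show ?thesis
  proof (cases "\<beta> $ i < \<gamma> $ i")
    case True
    then show ?thesis using i \<open>mdeg \<beta> = mdeg \<gamma>\<close> unfolding grlex_less_def by blast
  next
    case False
    then have "\<gamma> $ i < \<beta> $ i" using i by simp
    then have "\<gamma> \<prec>\<^sub>g \<beta>"
      using i \<open>mdeg \<beta> = mdeg \<gamma>\<close> unfolding grlex_less_def
      by (intro disjI2 conjI exI[of _ i]) auto
    then show ?thesis ..
  qed
qed (auto simp: grlex_less_def)

lemma ex1_grlex_enum:
  "\<exists>!f :: nat \<Rightarrow> nat ^ 'n::{finite,linorder}. bij f \<and> (\<forall>i j. i < j \<longrightarrow> f i \<prec>\<^sub>g f j)"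
proof -
  define below where "below \<beta> = {\<gamma>. \<gamma> \<prec>\<^sub>g \<beta>}" for \<beta> :: "nat ^ 'n::_"
  define rank where "rank \<beta> = card (below \<beta>)" for \<beta> :: "nat ^ 'n::_"
  have fin: "finite (below \<beta>)" for \<beta>
    by (rule finite_subset[OF _ finite_mdeg_le[of "mdeg \<beta>"]])
       (auto simp: below_def grlex_less_def)
  have rank_mono: "rank \<beta> < rank \<gamma>" if "\<beta> \<prec>\<^sub>g \<gamma>" for \<beta> \<gamma>
    unfolding rank_def
  proof (rule psubset_card_mono[OF fin])
    show "below \<beta> \<subset> below \<gamma>"
      using that grlex_trans grlex_irrefl unfolding below_def by blast
  qed
  have inj: "inj rank"
    by (rule injI) (metis grlex_total rank_mono less_irrefl)
  have down: "{..<rank \<beta>} \<subseteq> range rank" for \<beta>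
  proof -
    have "rank ` below \<beta> = {..<rank \<beta>}"
    proof (rule card_subset_eq)
      show "rank ` below \<beta> \<subseteq> {..<rank \<beta>}" by (auto simp: below_def rank_mono)
      show "card (rank ` below \<beta>) = card {..<rank \<beta>}"
        using card_image[OF inj_on_subset[OF inj subset_UNIV]] by (simp add: rank_def)
    qed simp
    then show ?thesis by blast
  qed
  have "inj (\<lambda>k. (\<chi> i. k) :: nat ^ 'n::_)" by (auto simp: inj_def fun_eq_iff)
  then have "infinite (UNIV :: (nat ^ 'n::_) set)"
    using finite_imageD finite_subset infinite_UNIV_nat subset_UNIV by metis
  then have inf: "infinite (range rank)" using finite_imageD[OF _ inj] by blast
  have surj: "surj rank"
  proof (rule UNIV_eq_I[symmetric])
    fix j
    obtain \<beta> where "j < rank \<beta>"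
      using inf unfolding infinite_nat_iff_unbounded by blast
    then show "j \<in> range rank" using down[of \<beta>] by auto
  qed
  have bij: "bij rank" using inj surj by (simp add: bij_def)
  show ?thesis
  proof (rule ex1I[of _ "inv_into UNIV rank"])
    have "inv_into UNIV rank i \<prec>\<^sub>g inv_into UNIV rank j" if "i < j" for i j
      using that surj by (metis grlex_total rank_mono not_less_iff_gr_or_eq surj_f_inv_f)
    then show "bij (inv_into UNIV rank) \<and> (\<forall>i j. i < j \<longrightarrow> inv_into UNIV rank i \<prec>\<^sub>g inv_into UNIV rank j)"
      using bij by (simp add: bij_imp_bij_inv)
  next
    fix f :: "nat \<Rightarrow> nat ^ 'n::_"
    assume f: "bij f \<and> (\<forall>i j. i < j \<longrightarrow> f i \<prec>\<^sub>g f j)"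
    have "rank (f j) = j" for j
    proof -
      have "below (f j) = f ` {..<j}"
      proof -
        have "f i \<prec>\<^sub>g f j \<longleftrightarrow> i < j" for i
          using f by (metis grlex_irrefl grlex_trans linorder_neqE_nat)
        then have "f -` below (f j) = {..<j}" by (auto simp: below_def)
        then show ?thesis using f surj_image_vimage_eq[of f] by (metis bij_is_surj)
      qed
      then show ?thesis
        using f by (simp add: rank_def card_image inj_on_subset[OF bij_is_inj])
    qed
    then show "f = inv_into UNIV rank" by (metis ext inj inv_f_f)
  qed
qed

definition vdm :: "nat \<Rightarrow> (nat \<Rightarrow> complex ^ 'n::{finite,linorder}) \<Rightarrow> complex" where
  "vdm k \<xi> = Determinant.det (Matrix.mat k k (\<lambda>(i, j). zmonom (grlex_enum i) (\<xi> j)))"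

definition max_vdm :: "(complex ^ 'n::{finite,linorder}) set \<Rightarrow> nat \<Rightarrow> real" where
  "max_vdm K k = (SUP \<xi> \<in> {\<xi>. \<forall>j<k. \<xi> j \<in> K}. cmod (vdm k \<xi>))"

definition poly_dim :: "nat \<Rightarrow> nat \<Rightarrow> nat" where
  "poly_dim n d = (n + d) choose n"

definition vdm_degree :: "nat \<Rightarrow> nat \<Rightarrow> nat" where
  "vdm_degree n d = (\<Sum>i = 1..d. i * (poly_dim n i - poly_dim n (i - 1)))"

text \<open>The upper limit is taken in \<open>ereal\<close>, so that it exists without any boundedness argument.\<close>

definition transfinite_diameter :: "(complex ^ 'n::{finite,linorder}) set \<Rightarrow> ereal" where
  "transfinite_diameter K =
     limsup (\<lambda>d. ereal (max_vdm K (poly_dim CARD('n) d) powr (1 / real (vdm_degree CARD('n) d))))"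

end

theory Submission
  imports Defs
begin

text \<open>
  Let \<open>P\<close> have degree at most \<open>d\<close> and let \<open>|\<beta>| = d\<close>. Differentiating \<open>P\<close> successively until only the
  coefficient of \<open>z\<^sup>\<beta>\<close> survives, each time in a variable whose exponent is maximal and hence at
  least \<open>1/n\<close> of the current degree, the Bernstein inequalities bound that coefficient by
  \<open>(nM)\<^sup>d max\<^sub>K |P|\<close>. As a function of its last point, the determinant \<open>VDM(\<xi>\<^sub>0,\<dots>,\<xi>\<^sub>k)\<close> is a polynomial
  whose coefficient at \<open>e\<^sub>k\<close> is \<open>VDM(\<xi>\<^sub>0,\<dots>,\<xi>\<^sub>k\<^sub>-\<^sub>1)\<close>, so \<open>V\<^sub>k \<le> (nM)\<^bsup>|\<alpha>(k)|\<^esup> V\<^sub>k\<^sub>+\<^sub>1\<close>. The degrees \<open>|\<alpha>(j)|\<close>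
  with \<open>j < h\<^sub>d\<close> sum up to \<open>l\<^sub>d\<close>, and therefore \<open>V \<ge> (nM)\<^bsup>-l\<^esup>\<close> for \<open>V\<close> at \<open>h\<^sub>d\<close> and \<open>l = l\<^sub>d\<close>.
\<close>

section \<open>Multi-indices and their degree\<close>

lemma mdeg_add: "mdeg (\<beta> + \<gamma>) = mdeg \<beta> + mdeg \<gamma>"
  by (simp add: mdeg_def sum.distrib)

lemma mdeg_axis [simp]: "mdeg (axis m k) = k"
  by (simp add: mdeg_def axis_def)

lemma mdeg_eq_0_iff: "mdeg \<beta> = 0 \<longleftrightarrow> \<beta> = 0"
  by (auto simp: mdeg_def Finite_Cartesian_Product.vec_eq_iff)

lemma axis_decompose:
  fixes \<beta> :: "nat ^ 'n::finite"
  assumes "\<beta> $ m \<noteq> 0"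
  obtains \<gamma> where "\<beta> = \<gamma> + axis m 1"
proof
  show "\<beta> = (\<beta> - axis m 1) + axis m 1"
    using assms by (auto simp: Finite_Cartesian_Product.vec_eq_iff axis_def)
qed

text \<open>The largest entry is at least the average. This is where the factor n in the final bound
  comes from.\<close>

lemma mdeg_le_card_times_component:
  fixes \<beta> :: "nat ^ 'n::finite"
  obtains m where "mdeg \<beta> \<le> CARD('n) * \<beta> $ m"
proof -
  have "Max (range (($) \<beta>)) \<in> range (($) \<beta>)" by (intro Max_in) auto
  then obtain m where m: "Max (range (($) \<beta>)) = \<beta> $ m" by (rule rangeE)
  have "\<beta> $ i \<le> \<beta> $ m" for i unfolding m[symmetric] by simp
  then have "mdeg \<beta> \<le> CARD('n) * \<beta> $ m"
    unfolding mdeg_def using sum_bounded_above[of UNIV "($) \<beta>" "\<beta> $ m"] by simp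
  then show thesis by (rule that)
qed

section \<open>Monomials, partial derivatives and the coefficient bound\<close>

lemma continuous_on_zmonom: "continuous_on A (zmonom \<beta>)"
  unfolding zmonom_def by (intro continuous_intros)

lemma zmonom_0 [simp]: "zmonom 0 z = 1"
  by (simp add: zmonom_def)

text \<open>If \<open>\<beta> $ m = 0\<close>, the truncated subtraction leaves the monomial
  unchanged, but the factor in front of it is then 0.\<close>

lemma has_field_derivative_zmonom:
  "((\<lambda>w. zmonom \<beta> (\<chi> i. if i = m then w else z $ i)) has_field_derivative
      of_nat (\<beta> $ m) * zmonom (\<beta> - axis m 1) z) (at (z $ m))"
proof -
  have "zmonom \<beta> (\<chi> i. if i = m then w else z $ i)
      = w ^ (\<beta> $ m) * (\<Prod>i\<in>UNIV - {m}. z $ i ^ (\<beta> $ i))" for w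
    unfolding zmonom_def by (subst prod.remove[of _ m]) (auto intro!: prod.cong)
  moreover have "zmonom (\<beta> - axis m 1) z
      = (z $ m) ^ (\<beta> $ m - 1) * (\<Prod>i\<in>UNIV - {m}. z $ i ^ (\<beta> $ i))"
    unfolding zmonom_def by (subst prod.remove[of _ m]) (auto intro!: prod.cong simp: axis_def)
  ultimately show ?thesis
    by (auto intro!: derivative_eq_intros)
qed

text \<open>The derivative gets the same normal form with shifted coefficients, so that an induction
  over the degree can be applied to it.\<close>

lemma partial_deriv_poly:
  fixes m :: "'n::finite"
  shows "partial_deriv m (\<lambda>z. \<Sum>\<gamma> | mdeg \<gamma> \<le> Suc d. c \<gamma> * zmonom \<gamma> z) =
   (\<lambda>z. \<Sum>\<gamma> | mdeg \<gamma> \<le> d. (of_nat (Suc (\<gamma> $ m)) * c (\<gamma> + axis m 1)) * zmonom \<gamma> z)"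
proof
  fix z :: "complex ^ 'n"
  have "partial_deriv m (\<lambda>z. \<Sum>\<gamma> | mdeg \<gamma> \<le> Suc d. c \<gamma> * zmonom \<gamma> z) z
      = (\<Sum>\<gamma> | mdeg \<gamma> \<le> Suc d. c \<gamma> * (of_nat (\<gamma> $ m) * zmonom (\<gamma> - axis m 1) z))"
    unfolding partial_deriv_def
    by (intro DERIV_imp_deriv DERIV_sum DERIV_cmult has_field_derivative_zmonom)
  \<comment> \<open>Indices outside the image of the shift have \<open>\<gamma> $ m = 0\<close>, and
    their terms vanish.\<close>
  also have "\<dots> = (\<Sum>\<gamma> \<in> (\<lambda>\<gamma>. \<gamma> + axis m 1) ` {\<gamma>. mdeg \<gamma> \<le> d}.
                    c \<gamma> * (of_nat (\<gamma> $ m) * zmonom (\<gamma> - axis m 1) z))"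
  proof (rule sum.mono_neutral_right)
    show "\<forall>\<gamma>\<in>{\<gamma>. mdeg \<gamma> \<le> Suc d} - (\<lambda>\<gamma>. \<gamma> + axis m 1) ` {\<gamma>. mdeg \<gamma> \<le> d}.
            c \<gamma> * (of_nat (\<gamma> $ m) * zmonom (\<gamma> - axis m 1) z) = 0"
    proof
      fix \<gamma> :: "nat ^ 'n"
      assume \<gamma>: "\<gamma> \<in> {\<gamma>. mdeg \<gamma> \<le> Suc d} - (\<lambda>\<gamma>. \<gamma> + axis m 1) ` {\<gamma>. mdeg \<gamma> \<le> d}"
      have "\<gamma> $ m = 0"
      proof (rule ccontr)
        assume "\<gamma> $ m \<noteq> 0"
        then obtain \<gamma>' where "\<gamma> = \<gamma>' + axis m 1" by (rule axis_decompose)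
        then show False using \<gamma> by (auto simp: mdeg_add)
      qed
      then show "c \<gamma> * (of_nat (\<gamma> $ m) * zmonom (\<gamma> - axis m 1) z) = 0" by simp
    qed
  qed (auto simp: finite_mdeg_le mdeg_add)
  also have "\<dots> = (\<Sum>\<gamma> | mdeg \<gamma> \<le> d.
      (of_nat (Suc (\<gamma> $ m)) * c (\<gamma> + axis m 1)) * zmonom \<gamma> z)"
    by (subst sum.reindex) (auto simp: inj_on_def axis_def intro!: sum.cong)
  finally show "partial_deriv m (\<lambda>z. \<Sum>\<gamma> | mdeg \<gamma> \<le> Suc d. c \<gamma> * zmonom \<gamma> z) z
    = (\<Sum>\<gamma> | mdeg \<gamma> \<le> d. (of_nat (Suc (\<gamma> $ m)) * c (\<gamma> + axis m 1)) * zmonom \<gamma> z)" .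
qed

text \<open>One induction step passes to the derivative in a variable \<open>m\<close> of maximal
  exponent: it costs M(d+1) by the Bernstein inequality and gains \<open>\<beta> $ m\<close>, which
  is at least (d+1)/n.\<close>

lemma bernstein_set_coeff_bound:
  fixes K :: "(complex ^ 'n::finite) set"
  assumes M: "M > 0" and K: "K \<noteq> {}" and B: "bernstein_set M K"
    and \<beta>: "mdeg \<beta> = d"
  shows "cmod (c \<beta>) \<le> (real CARD('n) * M) ^ d *
           sup_norm_on K (\<lambda>z. \<Sum>\<gamma> | mdeg \<gamma> \<le> d. c \<gamma> * zmonom \<gamma> z)"
  using \<beta>
proof (induction d arbitrary: \<beta> c)
  case 0
  then show ?case using K by (simp add: mdeg_eq_0_iff sup_norm_on_def)
next
  case (Suc d)
  define P where "P = (\<lambda>z. \<Sum>\<gamma> | mdeg \<gamma> \<le> Suc d. c \<gamma> * zmonom \<gamma> z)"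
  let ?n = "real CARD('n)"
  obtain m where m: "Suc d \<le> CARD('n) * \<beta> $ m"
    using mdeg_le_card_times_component[of \<beta>] Suc.prems by metis
  then have "\<beta> $ m \<noteq> 0" by (intro notI) simp
  then obtain \<gamma> where \<gamma>: "\<beta> = \<gamma> + axis m 1" by (rule axis_decompose)
  have m': "real (Suc d) \<le> ?n * real (Suc (\<gamma> $ m))"
    using m unfolding \<gamma> by (simp add: axis_def flip: of_nat_mult of_nat_Suc)
  have "mdeg \<gamma> = d" using Suc.prems \<gamma> by (simp add: mdeg_add)
  from Suc.IH[OF this, of "\<lambda>\<gamma>. of_nat (Suc (\<gamma> $ m)) * c (\<gamma> + axis m 1)"]
  have "real (Suc (\<gamma> $ m)) * cmod (c \<beta>) \<le> (?n * M) ^ d * sup_norm_on K (partial_deriv m P)"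
    unfolding P_def partial_deriv_poly \<gamma> by (simp only: norm_mult norm_of_nat)
  also have "sup_norm_on K (partial_deriv m P) \<le> M * real (Suc d) * sup_norm_on K P"
    using B unfolding bernstein_set_def poly_space_def P_def by blast
  finally have *: "real (Suc (\<gamma> $ m)) * cmod (c \<beta>)
      \<le> (?n * M) ^ d * (M * real (Suc d) * sup_norm_on K P)"
    using M by (simp add: mult_left_mono)
  have "0 \<le> ((?n * M) ^ d * (M * real (Suc d))) * sup_norm_on K P"
    unfolding mult.assoc[of "(?n * M) ^ d"] by (rule order_trans[OF _ *]) simp
  moreover have "0 < (?n * M) ^ d * (M * real (Suc d))"
    using M by (intro mult_pos_pos zero_less_power) auto
  ultimately have "0 \<le> sup_norm_on K P"
    by (metis zero_le_mult_iff not_le)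
  then have "(?n * M) ^ d * (M * real (Suc d) * sup_norm_on K P)
      \<le> (?n * M) ^ d * (M * (?n * real (Suc (\<gamma> $ m))) * sup_norm_on K P)"
    using M m' by (intro mult_left_mono mult_right_mono) auto
  also have "\<dots> = real (Suc (\<gamma> $ m)) * ((?n * M) ^ Suc d * sup_norm_on K P)"
    by (simp only: power_Suc mult_ac)
  finally have "real (Suc (\<gamma> $ m)) * cmod (c \<beta>)
      \<le> real (Suc (\<gamma> $ m)) * ((?n * M) ^ Suc d * sup_norm_on K P)"
    using * by (rule order_trans[rotated])
  then show ?case
    unfolding P_def by (rule mult_left_le_imp_le) simp
qed

section \<open>Vandermonde determinants along the graded lexicographic enumeration\<close>

lemma bij_grlex_enum: "bij (grlex_enum :: nat \<Rightarrow> nat ^ 'n::{finite,linorder})"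
  and grlex_enum_less: "i < j \<Longrightarrow> (grlex_enum i :: nat ^ 'n::{finite,linorder}) \<prec>\<^sub>g grlex_enum j"
  using theI'[OF ex1_grlex_enum[where 'n='n]] unfolding grlex_enum_def by blast+

lemma mdeg_grlex_enum_mono:
  assumes "i \<le> j"
  shows "mdeg (grlex_enum i :: nat ^ 'n::{finite,linorder}) \<le> mdeg (grlex_enum j :: nat ^ 'n::{finite,linorder})"
  using assms grlex_enum_less[of i j, where 'n='n]
  by (cases "i = j") (auto simp: grlex_less_def)

text \<open>Laplace expansion along the last column, the only one that contains \<open>z\<close>;
  the cofactors are the coefficients.\<close>

lemma vdm_Suc_in_last_point:
  fixes \<xi> :: "nat \<Rightarrow> complex ^ 'n::{finite,linorder}" and k :: nat
  defines "\<beta> \<equiv> (grlex_enum k :: nat ^ 'n::{finite,linorder})"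
  obtains c where "c \<beta> = vdm k \<xi>"
    and "\<And>z. vdm (Suc k) (\<xi>(k := z)) = (\<Sum>\<gamma> | mdeg \<gamma> \<le> mdeg \<beta>. c \<gamma> * zmonom \<gamma> z)"
proof -
  let ?\<alpha> = "grlex_enum :: nat \<Rightarrow> nat ^ 'n::_"
  define A where "A z = Matrix.mat (Suc k) (Suc k) (\<lambda>(i, j). zmonom (?\<alpha> i) ((\<xi>(k := z)) j))" for z
  define C where "C i = cofactor (A 0) i k" for i
  have "mat_delete (A z) i k = mat_delete (A 0) i k" for z i
    by (rule eq_matI) (auto simp: A_def mat_delete_def)
  then have cofactor: "cofactor (A z) i k = C i" for z i
    by (metis C_def cofactor_def)
  have expand: "vdm (Suc k) (\<xi>(k := z)) = (\<Sum>i<Suc k. C i * zmonom (?\<alpha> i) z)" for z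
  proof -
    have "vdm (Suc k) (\<xi>(k := z)) = (\<Sum>i<Suc k. A z $$ (i, k) * cofactor (A z) i k)"
      unfolding vdm_def A_def by (intro laplace_expansion_column) auto
    also have "\<dots> = (\<Sum>i<Suc k. C i * zmonom (?\<alpha> i) z)"
      by (intro sum.cong) (simp_all add: cofactor, simp_all add: A_def)
    finally show ?thesis .
  qed
  \<comment> \<open>The entry sits on the diagonal, so the cofactor carries the sign +1.\<close>
  have Ck: "C k = vdm k \<xi>"
  proof -
    have "mat_delete (A 0) k k = Matrix.mat k k (\<lambda>(i, j). zmonom (?\<alpha> i) (\<xi> j))"
      by (rule eq_matI) (auto simp: A_def mat_delete_def)
    then show ?thesis by (simp add: C_def cofactor_def vdm_def)
  qed
  \<comment> \<open>The cofactors are transported to multi-indices and padded with 0 on those that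
    come after \<open>?\<alpha> k\<close> but have the same degree, so that the sum runs over a full
    degree range.\<close>
  define c where "c \<gamma> = (if \<gamma> \<in> ?\<alpha> ` {..<Suc k} then C (inv_into UNIV ?\<alpha> \<gamma>) else 0)" for \<gamma>
  have inj: "inj ?\<alpha>" using bij_grlex_enum by (rule bij_is_inj)
  have c: "c (?\<alpha> i) = C i" if "i < Suc k" for i
    using that inj by (simp add: c_def)
  show thesis
  proof
    show "c \<beta> = vdm k \<xi>" unfolding \<beta>_def using c[of k] Ck by simp
    fix z
    have "vdm (Suc k) (\<xi>(k := z)) = (\<Sum>i<Suc k. c (?\<alpha> i) * zmonom (?\<alpha> i) z)"
      unfolding expand by (intro sum.cong) (auto simp: c)
    also have "\<dots> = (\<Sum>\<gamma>\<in>?\<alpha> ` {..<Suc k}. c \<gamma> * zmonom \<gamma> z)"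
      by (subst sum.reindex) (use inj in \<open>auto intro: inj_on_subset\<close>)
    also have "\<dots> = (\<Sum>\<gamma> | mdeg \<gamma> \<le> mdeg \<beta>. c \<gamma> * zmonom \<gamma> z)"
      by (intro sum.mono_neutral_left finite_mdeg_le)
        (auto simp: \<beta>_def c_def less_Suc_eq_le intro: mdeg_grlex_enum_mono)
    finally show "vdm (Suc k) (\<xi>(k := z)) = (\<Sum>\<gamma> | mdeg \<gamma> \<le> mdeg \<beta>. c \<gamma> * zmonom \<gamma> z)" .
  qed
qed

text \<open>The points are chosen greedily as in a Leja sequence: each new point maximises the
  determinant over \<open>K\<close> with the earlier points fixed. One fixed sequence of choices
  thus replaces the comparison of consecutive maxima.\<close>

lemma bernstein_set_vdm_lower_bound:
  fixes K :: "(complex ^ 'n::{finite,linorder}) set"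
  assumes M: "M > 0" and cK: "compact K" and K: "K \<noteq> {}" and B: "bernstein_set M K"
  shows "\<exists>\<xi>. (\<forall>j<k. \<xi> j \<in> K) \<and>
           1 \<le> (real CARD('n) * M) ^ (\<Sum>j<k. mdeg (grlex_enum j :: nat ^ 'n::{finite,linorder})) * cmod (vdm k \<xi>)"
proof (induction k)
  case 0
  \<comment> \<open>The empty determinant is 1.\<close>
  then show ?case by (simp add: vdm_def)
next
  case (Suc k)
  let ?\<alpha> = "grlex_enum :: nat \<Rightarrow> nat ^ 'n::_" and ?R = "real CARD('n) * M"
  from Suc obtain \<xi> where \<xi>: "\<forall>j<k. \<xi> j \<in> K"
    and low: "1 \<le> ?R ^ (\<Sum>j<k. mdeg (?\<alpha> j)) * cmod (vdm k \<xi>)" by blast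
  obtain c where c: "c (?\<alpha> k) = vdm k \<xi>"
    and P: "\<And>z. vdm (Suc k) (\<xi>(k := z)) = (\<Sum>\<gamma> | mdeg \<gamma> \<le> mdeg (?\<alpha> k). c \<gamma> * zmonom \<gamma> z)"
    by (rule vdm_Suc_in_last_point[where k=k and \<xi>=\<xi>]) (rule that)
  have "continuous_on K (\<lambda>z. cmod (vdm (Suc k) (\<xi>(k := z))))"
    unfolding P by (intro continuous_intros continuous_on_zmonom)
  from continuous_attains_sup[OF cK K this] obtain z where z: "z \<in> K"
    and max: "\<And>w. w \<in> K \<Longrightarrow> cmod (vdm (Suc k) (\<xi>(k := w))) \<le> cmod (vdm (Suc k) (\<xi>(k := z)))"
    by blast
  have "cmod (vdm k \<xi>) \<le> ?R ^ mdeg (?\<alpha> k) * sup_norm_on K (\<lambda>z. vdm (Suc k) (\<xi>(k := z)))"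
    unfolding P using bernstein_set_coeff_bound[OF M K B refl, of c "?\<alpha> k"] by (simp add: c)
  also have "sup_norm_on K (\<lambda>z. vdm (Suc k) (\<xi>(k := z))) \<le> cmod (vdm (Suc k) (\<xi>(k := z)))"
    unfolding sup_norm_on_def by (intro cSUP_least K max)
  finally have "cmod (vdm k \<xi>) \<le> ?R ^ mdeg (?\<alpha> k) * cmod (vdm (Suc k) (\<xi>(k := z)))"
    using M by (simp add: mult_left_mono)
  then have "1 \<le> ?R ^ (\<Sum>j<k. mdeg (?\<alpha> j)) * (?R ^ mdeg (?\<alpha> k) * cmod (vdm (Suc k) (\<xi>(k := z))))"
    using M by (intro order_trans[OF low] mult_left_mono) auto
  then have "1 \<le> ?R ^ (\<Sum>j<Suc k. mdeg (?\<alpha> j)) * cmod (vdm (Suc k) (\<xi>(k := z)))"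
    by (simp only: sum.lessThan_Suc power_add mult.assoc)
  moreover have "\<forall>j<Suc k. (\<xi>(k := z)) j \<in> K"
    using \<xi> z by (auto simp: less_Suc_eq)
  ultimately show ?case by blast
qed

text \<open>Makes the real supremum in \<open>max_vdm\<close> an upper bound of its values. The
  Leibniz formula reduces this to bounds for single monomials on \<open>K\<close>.\<close>

lemma bdd_above_vdm:
  fixes K :: "(complex ^ 'n::{finite,linorder}) set"
  assumes "compact K"
  shows "bdd_above ((\<lambda>\<xi>. cmod (vdm k \<xi>)) ` {\<xi>. \<forall>j<k. \<xi> j \<in> K})"
proof -
  let ?\<alpha> = "grlex_enum :: nat \<Rightarrow> nat ^ 'n::_"
  have "\<exists>b. \<forall>z\<in>K. cmod (zmonom (?\<alpha> i) z) \<le> b" for i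
    using compact_imp_bounded[OF compact_continuous_image[OF continuous_on_zmonom assms]]
    unfolding bounded_iff by blast
  then obtain b where b: "\<And>i z. z \<in> K \<Longrightarrow> cmod (zmonom (?\<alpha> i) z) \<le> b i" by metis
  show ?thesis
  proof (rule bdd_aboveI2)
    fix \<xi> :: "nat \<Rightarrow> complex ^ 'n::_" assume \<xi>: "\<xi> \<in> {\<xi>. \<forall>j<k. \<xi> j \<in> K}"
    have "cmod (vdm k \<xi>) \<le> (\<Sum>p | p permutes {0..<k}. cmod (signof p * (\<Prod>i = 0..<k. zmonom (?\<alpha> i) (\<xi> (p i)))))"
      unfolding vdm_def Determinant.det_def
      by (auto intro!: order_trans[OF norm_sum] sum_mono simp: norm_mult)
    also have "\<dots> \<le> (\<Sum>p | p permutes {0..<k}. \<Prod>i = 0..<k. b i)"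
    proof (rule sum_mono)
      fix p assume "p \<in> {p. p permutes {0..<k}}"
      then have "p i < k" if "i < k" for i
        using that permutes_in_image[of p "{0..<k}" i] by simp
      then have "(\<Prod>i = 0..<k. cmod (zmonom (?\<alpha> i) (\<xi> (p i)))) \<le> (\<Prod>i = 0..<k. b i)"
        using \<xi> b by (intro prod_mono) auto
      then show "cmod (signof p * (\<Prod>i = 0..<k. zmonom (?\<alpha> i) (\<xi> (p i)))) \<le> (\<Prod>i = 0..<k. b i)"
        by (simp add: norm_mult prod_norm sign_def)
    qed
    finally show "cmod (vdm k \<xi>) \<le> (\<Sum>p | p permutes {0..<k}. \<Prod>i = 0..<k. b i)" .
  qed
qed

lemma bernstein_set_max_vdm_lower_bound:
  fixes K :: "(complex ^ 'n::{finite,linorder}) set"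
  assumes M: "M > 0" and cK: "compact K" and K: "K \<noteq> {}" and B: "bernstein_set M K"
  shows "(1 / (real CARD('n) * M)) ^ (\<Sum>j<k. mdeg (grlex_enum j :: nat ^ 'n::_)) \<le> max_vdm K k"
proof -
  let ?R = "real CARD('n) * M" and ?s = "\<Sum>j<k. mdeg (grlex_enum j :: nat ^ 'n::{finite,linorder})"
  obtain \<xi> where \<xi>: "\<forall>j<k. \<xi> j \<in> K" and low: "1 \<le> ?R ^ ?s * cmod (vdm k \<xi>)"
    using bernstein_set_vdm_lower_bound[OF assms] by blast
  have "(1 / ?R) ^ ?s \<le> cmod (vdm k \<xi>)"
    using low M by (simp add: power_one_over divide_le_eq mult.commute)
  also have "\<dots> \<le> max_vdm K k"
    unfolding max_vdm_def using \<xi> by (intro cSUP_upper bdd_above_vdm cK) auto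
  finally show ?thesis .
qed

section \<open>Counting multi-indices and summing their degrees\<close>

lemma card_mdeg_le: "card {\<beta> :: nat ^ 'n::finite. mdeg \<beta> \<le> d} = poly_dim CARD('n) d"
proof -
  obtain xs :: "'n list" where xs: "set xs = UNIV" "distinct xs"
    using finite_distinct_list[of "UNIV :: 'n set"] by auto
  have len: "length xs = CARD('n)" using xs distinct_card[of xs] by simp
  have sum_xs: "sum_list (map (($) \<beta>) xs) = mdeg \<beta>" for \<beta> :: "nat ^ 'n"
    using xs by (simp add: mdeg_def sum_list_distinct_conv_sum_set)
  \<comment> \<open>The leading entry is the slack that turns \<open>mdeg \<beta> \<le> d\<close> into an equation.\<close>
  define F where "F \<beta> = (d - mdeg \<beta>) # map (($) \<beta>) xs" for \<beta> :: "nat ^ 'n"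
  have "bij_betw F {\<beta>. mdeg \<beta> \<le> d} {l. length l = Suc CARD('n) \<and> sum_list l = d}"
    unfolding bij_betw_def
  proof (intro conjI equalityI subsetI)
    show "inj_on F {\<beta>. mdeg \<beta> \<le> d}"
      using xs by (auto simp: inj_on_def F_def Finite_Cartesian_Product.vec_eq_iff)
    show "l \<in> {l. length l = Suc CARD('n) \<and> sum_list l = d}" if "l \<in> F ` {\<beta>. mdeg \<beta> \<le> d}" for l
      using that by (auto simp: F_def len sum_xs)
  next
    fix l assume "l \<in> {l. length l = Suc CARD('n) \<and> sum_list l = d}"
    then obtain a ys where l: "l = a # ys" and ys: "length ys = length xs" "a + sum_list ys = d"
      by (cases l) (auto simp: len)
    \<comment> \<open>The inverse of \<open>F\<close>: the tail \<open>ys\<close> is read as a table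
      of values along \<open>xs\<close>.\<close>
    define \<beta> :: "nat ^ 'n" where "\<beta> = (\<chi> i. the (map_of (zip xs ys) i))"
    have \<beta>: "map (($) \<beta>) xs = ys"
      using ys xs by (auto intro!: nth_equalityI simp: \<beta>_def map_of_zip_nth)
    then have "mdeg \<beta> = sum_list ys" using sum_xs[of \<beta>] by simp
    then have "l = F \<beta>" "mdeg \<beta> \<le> d" using \<beta> ys by (auto simp: F_def l)
    then show "l \<in> F ` {\<beta>. mdeg \<beta> \<le> d}" by blast
  qed
  then have "card {\<beta> :: nat ^ 'n. mdeg \<beta> \<le> d} = (d + CARD('n)) choose d"
    using bij_betw_same_card card_length_sum_list[of "Suc CARD('n)" d] by fastforce
  then show ?thesis
    using binomial_symmetric[of d "d + CARD('n)"] by (simp add: poly_dim_def add.commute)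
qed

text \<open>Degrees do not decrease along the enumeration, so the indices of degree at most
  \<open>d\<close> form an initial segment, whose length is known by counting.\<close>

lemma grlex_enum_image_poly_dim:
  "grlex_enum ` {..<poly_dim CARD('n) d} = {\<beta> :: nat ^ 'n::{finite,linorder}. mdeg \<beta> \<le> d}"
proof -
  let ?\<alpha> = "grlex_enum :: nat \<Rightarrow> nat ^ 'n::_"
  let ?I = "{i. mdeg (?\<alpha> i) \<le> d}"
  have im: "?\<alpha> ` ?I = {\<beta>. mdeg \<beta> \<le> d}"
    using surj_image_vimage_eq[OF bij_is_surj[OF bij_grlex_enum], of "{\<beta> :: nat ^ 'n::_. mdeg \<beta> \<le> d}"]
    by (simp add: vimage_def)
  have inj: "inj_on ?\<alpha> A" for A
    using bij_is_inj[OF bij_grlex_enum] by (rule inj_on_subset) simp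
  have card: "card ?I = poly_dim CARD('n) d"
    using card_image[OF inj, of ?I] by (simp add: im card_mdeg_le)
  have fin: "finite ?I"
    using finite_imageD[OF _ inj, of ?I] im finite_mdeg_le[of d, where 'n='n] by simp
  have "?I = {..<card ?I}"
  proof (rule card_subset_eq[symmetric, OF fin])
    show "{..<card ?I} \<subseteq> ?I"
    proof
      fix i assume i: "i \<in> {..<card ?I}"
      \<comment> \<open>\<open>?I\<close> has more than \<open>i\<close> elements, hence one that is
        at least \<open>i\<close>; monotonicity of the degree then brings \<open>i\<close> itself
        into \<open>?I\<close>.\<close>
      have "\<not> ?I \<subseteq> {..<i}" using i card_mono[of "{..<i}" ?I] by auto
      then obtain j where "j \<in> ?I" "j \<notin> {..<i}" by blast
      then show "i \<in> ?I" using mdeg_grlex_enum_mono[of i j, where 'n='n] by simp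
    qed
  qed simp
  then show ?thesis using im card by simp
qed

text \<open>Exactly h_i - h_(i-1) multi-indices have degree i; the induction adds one such layer at
  a time.\<close>

lemma sum_mdeg_le:
  "(\<Sum>\<beta> :: nat ^ 'n::finite | mdeg \<beta> \<le> d. mdeg \<beta>) = vdm_degree CARD('n) d"
proof (induction d)
  case 0
  then show ?case by (simp add: vdm_degree_def)
next
  case (Suc d)
  let ?S = "\<lambda>d. {\<beta> :: nat ^ 'n. mdeg \<beta> \<le> d}"
  have sub: "?S d \<subseteq> ?S (Suc d)" by auto
  have "(\<Sum>\<beta>\<in>?S (Suc d). mdeg \<beta>) = (\<Sum>\<beta>\<in>?S (Suc d) - ?S d. mdeg \<beta>) + (\<Sum>\<beta>\<in>?S d. mdeg \<beta>)"
    by (rule sum.subset_diff[OF sub finite_mdeg_le])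
  also have "(\<Sum>\<beta>\<in>?S (Suc d) - ?S d. mdeg \<beta>) = (\<Sum>\<beta>\<in>?S (Suc d) - ?S d. Suc d)"
    by (rule sum.cong) auto
  also have "\<dots> = Suc d * (poly_dim CARD('n) (Suc d) - poly_dim CARD('n) d)"
    by (simp add: card_Diff_subset[OF finite_mdeg_le sub] card_mdeg_le)
  finally show ?case using Suc.IH by (simp add: vdm_degree_def)
qed

lemma sum_mdeg_grlex_enum:
  "(\<Sum>j<poly_dim CARD('n) d. mdeg (grlex_enum j :: nat ^ 'n::{finite,linorder}))
     = vdm_degree CARD('n) d"
proof -
  have "inj_on (grlex_enum :: nat \<Rightarrow> nat ^ 'n::_) {..<poly_dim CARD('n) d}"
    using bij_is_inj[OF bij_grlex_enum] by (rule inj_on_subset) simp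
  then show ?thesis
    unfolding sum_mdeg_le[symmetric] grlex_enum_image_poly_dim[symmetric]
    by (simp add: sum.reindex)
qed

lemma vdm_degree_pos:
  assumes "n > 0" "d > 0"
  shows "vdm_degree n d > 0"
proof -
  \<comment> \<open>The summand for i = 1 is h_1 - h_0 = n.\<close>
  have "1 * (poly_dim n 1 - poly_dim n (1 - 1)) \<le> vdm_degree n d"
    unfolding vdm_degree_def using assms by (intro member_le_sum) auto
  then show ?thesis using assms by (simp add: poly_dim_def)
qed

theorem theorem1p1:
  fixes K :: "(complex ^ 'n::{finite,linorder}) set" and M :: real
  assumes "M > 0"
    and "compact K" and "K \<noteq> {}"
    and "bernstein_set M K"
  shows "transfinite_diameter K \<ge> ereal (1 / (real CARD('n) * M))"
proof -
  let ?r = "1 / (real CARD('n) * M)"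
  have r: "?r > 0" using assms(1) by simp
  \<comment> \<open>At d = 0 the exponent degenerates, as l_0 = 0 and \<open>1 / 0 = 0\<close>; the
    upper limit only needs the bound eventually.\<close>
  have "?r \<le> max_vdm K (poly_dim CARD('n) d) powr (1 / real (vdm_degree CARD('n) d))"
    if d: "d > 0" for d
  proof -
    let ?l = "vdm_degree CARD('n) d"
    have l: "?l > 0" using d by (intro vdm_degree_pos) auto
    have "?r = (?r ^ ?l) powr (1 / real ?l)"
      using r l by (simp only: powr_realpow[symmetric] powr_powr) simp
    also have "\<dots> \<le> max_vdm K (poly_dim CARD('n) d) powr (1 / real ?l)"
      using bernstein_set_max_vdm_lower_bound[OF assms, of "poly_dim CARD('n) d"] r
      unfolding sum_mdeg_grlex_enum by (intro powr_mono2) auto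
    finally show ?thesis .
  qed
  then have "\<forall>\<^sub>F d in sequentially. ereal ?r
      \<le> ereal (max_vdm K (poly_dim CARD('n) d) powr (1 / real (vdm_degree CARD('n) d)))"
    by (intro eventually_mono[OF eventually_gt_at_top[of 0]]) simp
  then show ?thesis
    unfolding transfinite_diameter_def by (intro le_Limsup) simp_all
qed

end
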